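(* Let $G=(N,A)$ be a directed graph with $N=\{1,\dots,n\}$ and $m$ arcs. If $Q\in\mathbb{R}^{m\times m}$ is a generalized weak sum matrix with supporting matrices $B,C\in\mathbb{R}^{m\times n}$ and $D,T\in\mathbb{R}^{n\times m}$, then $Q$ is linearizable with cost vector $p$ given by $$p_{ij}=\sum_{k=1}^n b_{ij,k}+\sum_{k=1}^n c_{ij,k}+\sum_{k=1}^n d_{k,ij}+\sum_{k=1}^n t_{k,ij}\qquad\text{for all }(i,j)\in A,$$ i.e. $x^TQx=p^Tx$ for all $x\in X$.
   Context: $G=(N,A)$ is a directed graph, $A\subseteq N\times N$, $|A|=m$; an arc is written $(i,j)$ (from $i$ to $j$), or $ij$ when used as an index, and $Q_{ij,kl}$ denotes the entry of $Q$ indexed by the arcs $(i,j)$ and $(k,l)$. Here $Q$ may have nonzero entries for arbitrary pairs of arcs (not only consecutive ones). For $i\in N$, $\delta^+(i)$ and $\delta^-(i)$ are the sets of arcs leaving and entering $i$. The set of (disjoint) cycle covers is $$X=\Big\{x\in\{0,1\}^m : \sum_{e\in\delta^+(i)}x_e=\sum_{e\in\delta^-(i)}x_e=1\ \ \forall i\in N\Big\}.$$ $Q$ is linearizable with cost vector $p\in\mathbb{R}^m$ if $x^TQx=p^Tx$ for all $x\in X$. $Q$ is a generalized weak sum matrix with supporting matrices $B=(b_{ij,k}),C=(c_{ij,k})\in\mathbb{R}^{m\times n}$ and $D=(d_{k,ij}),T=(t_{k,ij})\in\mathbb{R}^{n\times m}$ if $Q_{ij,kl}=b_{ij,k}+c_{ij,l}+d_{i,kl}+t_{j,kl}$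 for all $i,j,k,l$ with $(i,j),(k,l)\in A$. *)

theory Defs
  imports Complex_Main "HOL-Library.FuncSet" "Graph_Theory.Pair_Digraph"
begin

text \<open>
  Vectors and matrices indexed by the arc set are functions on pairs of vertices of which only
  the values at arcs matter. An \<open>n \<times> m\<close> or \<open>m \<times> n\<close> matrix, with one index a vertex and the
  other an arc, is a curried function whose arguments come in the order (row, column).
  Loops and opposite arcs are allowed: the only restriction on arcs is that their ends
  are vertices.
\<close>

definition cycle_covers :: "'a pair_pre_digraph \<Rightarrow> ('a \<times> 'a \<Rightarrow> real) set" where
  "cycle_covers G =
    {x \<in> parcs G \<rightarrow>\<^sub>E {0, 1}.
      \<forall>i\<in>pverts G. (\<Sum>e\<in>out_arcs (with_proj G) i. x e) = 1 \<and>
                   (\<Sum>e\<in>in_arcs (with_proj G) i. x e) = 1}"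

definition linearizable_with ::
  "'a pair_pre_digraph \<Rightarrow> ('a \<times> 'a \<Rightarrow> 'a \<times> 'a \<Rightarrow> real) \<Rightarrow> ('a \<times> 'a \<Rightarrow> real) \<Rightarrow> bool" where
  "linearizable_with G Q p \<longleftrightarrow>
    (\<forall>x\<in>cycle_covers G.
      (\<Sum>e\<in>parcs G. \<Sum>f\<in>parcs G. x e * Q e f * x f) = (\<Sum>e\<in>parcs G. p e * x e))"

definition generalized_weak_sum_matrix ::
  "'a pair_pre_digraph \<Rightarrow> ('a \<times> 'a \<Rightarrow> 'a \<times> 'a \<Rightarrow> real) \<Rightarrow>
    ('a \<times> 'a \<Rightarrow> 'a \<Rightarrow> real) \<Rightarrow> ('a \<times> 'a \<Rightarrow> 'a \<Rightarrow> real) \<Rightarrow>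
    ('a \<Rightarrow> 'a \<times> 'a \<Rightarrow> real) \<Rightarrow> ('a \<Rightarrow> 'a \<times> 'a \<Rightarrow> real) \<Rightarrow> bool" where
  "generalized_weak_sum_matrix G Q B C D T \<longleftrightarrow>
    (\<forall>i j k l. (i, j) \<in> parcs G \<longrightarrow> (k, l) \<in> parcs G \<longrightarrow>
      Q (i, j) (k, l) = B (i, j) k + C (i, j) l + D i (k, l) + T j (k, l))"

end

theory Submission
  imports Defs
begin

text \<open>
  A cycle cover contains exactly one arc leaving and exactly one arc entering each vertex.
  Hence, as an arc runs through a cycle cover, its tail runs through every vertex exactly once,
  and so does its head: a cost on arcs that depends only on the tail, or only on the head,
  has the same total on all cycle covers, namely the sum of that cost over the vertices
  (\<open>cover_sum_tail\<close> and \<open>cover_sum_head\<close>).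

  In \<open>x\<^sup>T Q x\<close> each of the four terms of a generalized weak sum matrix depends on one of the two
  arcs in full but on only one end of the other. Summing over the latter arc first removes that
  end and leaves a cost that is linear in the remaining arc; the four linear costs add up
  to \<open>p\<close>.
\<close>

text \<open>
  Grouped by tail, the arcs split into the sets \<open>\<delta>\<^sup>+(i)\<close>; on each of them \<open>g\<close> is constant and the
  entries of \<open>x\<close> add up to 1.
\<close>

lemma cover_sum_tail:
  fixes g :: "'a \<Rightarrow> real"
  assumes "pair_fin_digraph G" and "x \<in> cycle_covers G"
  shows "(\<Sum>e\<in>parcs G. g (fst e) * x e) = (\<Sum>i\<in>pverts G. g i)"
proof -
  interpret pair_fin_digraph G by fact
  have "(\<Sum>e\<in>parcs G. g (fst e) * x e)
      = (\<Sum>i\<in>pverts G. \<Sum>e\<in>{e \<in> parcs G. fst e = i}. g (fst e) * x e)"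
    by (intro sum.group[symmetric]) (auto intro: in_arcsD1)
  also have "\<dots> = (\<Sum>i\<in>pverts G. g i * (\<Sum>e\<in>out_arcs (with_proj G) i. x e))"
    by (simp add: out_arcs_def sum_distrib_left)
  also have "\<dots> = (\<Sum>i\<in>pverts G. g i)"
    using assms(2) by (simp add: cycle_covers_def)
  finally show ?thesis .
qed

text \<open>The same argument with the sets \<open>\<delta>\<^sup>-(i)\<close> of entering arcs.\<close>

lemma cover_sum_head:
  fixes g :: "'a \<Rightarrow> real"
  assumes "pair_fin_digraph G" and "x \<in> cycle_covers G"
  shows "(\<Sum>e\<in>parcs G. g (snd e) * x e) = (\<Sum>i\<in>pverts G. g i)"
proof -
  interpret pair_fin_digraph G by fact
  have "(\<Sum>e\<in>parcs G. g (snd e) * x e)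
      = (\<Sum>i\<in>pverts G. \<Sum>e\<in>{e \<in> parcs G. snd e = i}. g (snd e) * x e)"
    by (intro sum.group[symmetric]) (auto intro: in_arcsD2)
  also have "\<dots> = (\<Sum>i\<in>pverts G. g i * (\<Sum>e\<in>in_arcs (with_proj G) i. x e))"
    by (simp add: in_arcs_def sum_distrib_left)
  also have "\<dots> = (\<Sum>i\<in>pverts G. g i)"
    using assms(2) by (simp add: cycle_covers_def)
  finally show ?thesis .
qed

theorem proposition5:
  fixes G :: "nat pair_pre_digraph" and n :: nat
    and Q :: "nat \<times> nat \<Rightarrow> nat \<times> nat \<Rightarrow> real"
    and B C :: "nat \<times> nat \<Rightarrow> nat \<Rightarrow> real"
    and D T :: "nat \<Rightarrow> nat \<times> nat \<Rightarrow> real"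
    and p :: "nat \<times> nat \<Rightarrow> real"
  assumes "pair_fin_digraph G"
    and "pverts G = {1..n}"
    and "generalized_weak_sum_matrix G Q B C D T"
    and "\<And>i j. (i, j) \<in> parcs G \<Longrightarrow>
      p (i, j) = (\<Sum>k=1..n. B (i, j) k) + (\<Sum>k=1..n. C (i, j) k)
               + (\<Sum>k=1..n. D k (i, j)) + (\<Sum>k=1..n. T k (i, j))"
  shows "linearizable_with G Q p"
  unfolding linearizable_with_def
proof
  fix x assume x: "x \<in> cycle_covers G"
  let ?A = "parcs G" and ?V = "pverts G"
  note tail = cover_sum_tail[OF assms(1) x] and head = cover_sum_head[OF assms(1) x]
  have Q: "Q e f = B e (fst f) + C e (snd f) + D (fst e) f + T (snd e) f"
    if "e \<in> ?A" "f \<in> ?A" for e f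
    using assms(3) that by (cases e; cases f) (simp add: generalized_weak_sum_matrix_def)
  have p: "p e = (\<Sum>k\<in>?V. B e k) + (\<Sum>k\<in>?V. C e k) + (\<Sum>k\<in>?V. D k e) + (\<Sum>k\<in>?V. T k e)"
    if "e \<in> ?A" for e
    using assms(2,4) that by (cases e) simp
  have "(\<Sum>e\<in>?A. \<Sum>f\<in>?A. x e * Q e f * x f)
      = (\<Sum>e\<in>?A. \<Sum>f\<in>?A. x e * (B e (fst f) * x f) + x e * (C e (snd f) * x f)
          + x f * (D (fst e) f * x e) + x f * (T (snd e) f * x e))"
    by (intro sum.cong refl) (simp add: Q algebra_simps)
  also have "\<dots> = (\<Sum>e\<in>?A. x e * (\<Sum>f\<in>?A. B e (fst f) * x f))
      + (\<Sum>e\<in>?A. x e * (\<Sum>f\<in>?A. C e (snd f) * x f))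
      + (\<Sum>e\<in>?A. \<Sum>f\<in>?A. x f * (D (fst e) f * x e))
      + (\<Sum>e\<in>?A. \<Sum>f\<in>?A. x f * (T (snd e) f * x e))"
    by (simp add: sum.distrib sum_distrib_left)
  \<comment> \<open>In the terms of \<open>D\<close> and \<open>T\<close> it is the first arc that contributes only one end,
    so there the order of summation is exchanged.\<close>
  also have "(\<Sum>e\<in>?A. \<Sum>f\<in>?A. x f * (D (fst e) f * x e))
      = (\<Sum>f\<in>?A. x f * (\<Sum>e\<in>?A. D (fst e) f * x e))"
    by (subst sum.swap) (simp add: sum_distrib_left)
  also have "(\<Sum>e\<in>?A. \<Sum>f\<in>?A. x f * (T (snd e) f * x e))
      = (\<Sum>f\<in>?A. x f * (\<Sum>e\<in>?A. T (snd e) f * x e))"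
    by (subst sum.swap) (simp add: sum_distrib_left)
  also have "(\<Sum>e\<in>?A. x e * (\<Sum>f\<in>?A. B e (fst f) * x f))
      + (\<Sum>e\<in>?A. x e * (\<Sum>f\<in>?A. C e (snd f) * x f))
      + (\<Sum>f\<in>?A. x f * (\<Sum>e\<in>?A. D (fst e) f * x e))
      + (\<Sum>f\<in>?A. x f * (\<Sum>e\<in>?A. T (snd e) f * x e))
      = (\<Sum>e\<in>?A. x e * (\<Sum>k\<in>?V. B e k)) + (\<Sum>e\<in>?A. x e * (\<Sum>k\<in>?V. C e k))
      + (\<Sum>f\<in>?A. x f * (\<Sum>k\<in>?V. D k f)) + (\<Sum>f\<in>?A. x f * (\<Sum>k\<in>?V. T k f))"
    unfolding tail[of "B _"] head[of "C _"]
      tail[of "\<lambda>i. D i _"] head[of "\<lambda>i. T i _"] ..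
  also have "\<dots> = (\<Sum>e\<in>?A. p e * x e)"
    unfolding sum.distrib[of _ _ ?A, symmetric]
    by (intro sum.cong refl) (simp add: p algebra_simps)
  finally show "(\<Sum>e\<in>?A. \<Sum>f\<in>?A. x e * Q e f * x f) = (\<Sum>e\<in>?A. p e * x e)" .
qed

end
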